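(* Suppose that at least one of the following two conditions holds: (cs1) $\lambda^{(n)}>0$ for all $n\in\mathcal{N}$; (cs2) for every (directed) cycle in the Leader-graph, at least one user participating in the cycle has a leader $k$ with positive self-post rate $\lambda^{(k)}>0$. Then for each $i\in\mathcal{N}$ the linear system $$\mathbf{p}_i=\mathbf{A}\,\mathbf{p}_i+\mathbf{b}_i,\qquad \mathbf{q}_i=\mathbf{C}\,\mathbf{p}_i+\mathbf{d}_i$$ in the unknowns $\mathbf{p}_i,\mathbf{q}_i\in\mathbb{R}^N$ has a unique solution, given by $$\mathbf{p}_i=(\mathbf{I}_N-\mathbf{A})^{-1}\mathbf{b}_i,\qquad \mathbf{q}_i=\mathbf{C}(\mathbf{I}_N-\mathbf{A})^{-1}\mathbf{b}_i+\mathbf{d}_i$$ (in particular $\mathbf{I}_N-\mathbf{A}$ is invertible).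
   Context: $\mathcal{N}=\{1,\dots,N\}$ is a finite set of users. Each user $n$ has a nonempty set of leaders $\mathcal{L}^{(n)}\subseteq\mathcal{N}\setminus\{n\}$, a self-post rate $\lambda^{(n)}\ge0$ and a re-post rate $\mu^{(n)}\ge0$, with $\lambda^{(n)}+\mu^{(n)}>0$. The Leader-graph is the directed graph on $\mathcal{N}$ with an edge from $i$ to $j$ exactly when $i\in\mathcal{L}^{(j)}$. $\mathbf{I}_N$ is the $N\times N$ identity matrix. $\mathbf{A}=(a_{j,k})$ and $\mathbf{C}=(c_{j,k})$ are $N\times N$ matrices and $\mathbf{b}_i=(b_{j,i})_{j=1}^N$, $\mathbf{d}_i=(d_{j,i})_{j=1}^N$ are column vectors with entries $$a_{j,k}=\frac{\mu^{(k)}\,\mathbf{1}_{\{k\in\mathcal{L}^{(j)}\}}}{\sum_{\ell\in\mathcal{L}^{(j)}}(\lambda^{(\ell)}+\mu^{(\ell)})},\quad b_{j,i}=\frac{\lambda^{(i)}\,\mathbf{1}_{\{i\in\mathcal{L}^{(j)}\}}}{\sum_{\ell\in\mathcal{L}^{(j)}}(\lambda^{(\ell)}+\mu^{(\ell)})},\quad c_{j,k}=\frac{\mu^{(j)}\,\mathbf{1}_{\{j=k\}}}{\lambda^{(j)}+\mu^{(j)}},\quad d_{j,i}=\frac{\lambda^{(i)}\,\mathbf{1}_{\{j=i\}}}{\lambda^{(i)}+\mu^{(i)}}.$$ *)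

theory Defs
  imports "HOL-Analysis.Analysis" "Graph_Theory.Arc_Walk"
begin

text \<open>
  The users are the elements of a finite type \<open>'n\<close>. \<open>L n\<close> is the set of leaders of user \<open>n\<close>,
  and \<open>lam n\<close>, \<open>mu n\<close> are the self-post and re-post rates.
\<close>

definition leader_graph :: "('n \<Rightarrow> 'n set) \<Rightarrow> ('n, 'n \<times> 'n) pre_digraph" where
  "leader_graph L = \<lparr>verts = UNIV, arcs = {(i, j). i \<in> L j}, tail = fst, head = snd\<rparr>"

text \<open>
  A cycle is represented by the list of its arcs; it is nonempty and closed, so every vertex
  on it is the tail of one of its arcs.
\<close>

definition cycle_users :: "('n \<times> 'n) list \<Rightarrow> 'n set" where
  "cycle_users c = fst ` set c"

definition cs1 :: "('n \<Rightarrow> real) \<Rightarrow> bool" where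
  "cs1 lam \<longleftrightarrow> (\<forall>n. lam n > 0)"

definition cs2 :: "('n \<Rightarrow> 'n set) \<Rightarrow> ('n \<Rightarrow> real) \<Rightarrow> bool" where
  "cs2 L lam \<longleftrightarrow>
    (\<forall>c. pre_digraph.cycle (leader_graph L) c \<longrightarrow>
      (\<exists>n\<in>cycle_users c. \<exists>k\<in>L n. lam k > 0))"

definition A_mat ::
    "('n::finite \<Rightarrow> 'n set) \<Rightarrow> ('n \<Rightarrow> real) \<Rightarrow> ('n \<Rightarrow> real) \<Rightarrow> real^'n^'n" where
  "A_mat L lam mu = (\<chi> j k. mu k * of_bool (k \<in> L j) / (\<Sum>l\<in>L j. lam l + mu l))"

definition b_vec ::
    "('n::finite \<Rightarrow> 'n set) \<Rightarrow> ('n \<Rightarrow> real) \<Rightarrow> ('n \<Rightarrow> real) \<Rightarrow> 'n \<Rightarrow> real^'n" where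
  "b_vec L lam mu i = (\<chi> j. lam i * of_bool (i \<in> L j) / (\<Sum>l\<in>L j. lam l + mu l))"

definition C_mat :: "('n::finite \<Rightarrow> real) \<Rightarrow> ('n \<Rightarrow> real) \<Rightarrow> real^'n^'n" where
  "C_mat lam mu = (\<chi> j k. mu j * of_bool (j = k) / (lam j + mu j))"

definition d_vec :: "('n::finite \<Rightarrow> real) \<Rightarrow> ('n \<Rightarrow> real) \<Rightarrow> 'n \<Rightarrow> real^'n" where
  "d_vec lam mu i = (\<chi> j. lam i * of_bool (j = i) / (lam i + mu i))"

definition solves_system ::
    "('n::finite \<Rightarrow> 'n set) \<Rightarrow> ('n \<Rightarrow> real) \<Rightarrow> ('n \<Rightarrow> real) \<Rightarrow> 'n \<Rightarrow> real^'n \<Rightarrow> real^'n \<Rightarrow> bool" where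
  "solves_system L lam mu i p q \<longleftrightarrow>
    p = A_mat L lam mu *v p + b_vec L lam mu i \<and>
    q = C_mat lam mu *v p + d_vec lam mu i"

end

theory Submission
  imports Defs "Graph_Theory.Digraph_Component"
begin

text \<open>
  A nonzero fixed point \<open>x\<close> of \<open>A\<close> has a nonempty set of users \<open>j\<close> with \<open>\<bar>x j\<bar>\<close> maximal.
  Since row \<open>j\<close> of \<open>A\<close> consists of the re-post parts of a probability vector on \<open>L j\<close>, the
  equation at such a \<open>j\<close> forces all leaders of \<open>j\<close> to have self-post rate zero and to be maximal
  as well. Walking backwards along leaders inside this set closes up to a cycle none of whose
  users has a leader with positive self-post rate.
\<close>

text \<open>If no vertex reached itself, the finite relation \<open>arcs_ends G\<close> would be
  well-founded, and a minimal vertex would have no incoming arc. So there is a nonempty closed walk,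
  and any such walk contains a cycle.\<close>

lemma (in wf_digraph) exists_cycle_of_in_arcs:
  assumes "finite (arcs G)" and "verts G \<noteq> {}"
    and in_arc: "\<And>v. v \<in> verts G \<Longrightarrow> \<exists>e\<in>arcs G. head G e = v"
  shows "\<exists>c. cycle c"
proof -
  have "\<not> acyclic (arcs_ends G)"
  proof
    assume "acyclic (arcs_ends G)"
    moreover have "finite (arcs_ends G)"
      using assms(1) by (simp add: arcs_ends_conv)
    ultimately have "wf (arcs_ends G)"
      by (rule finite_acyclic_wf[rotated])
    then obtain z where z: "z \<in> verts G" "\<And>y. (y, z) \<in> arcs_ends G \<Longrightarrow> y \<notin> verts G"
      using wfE_min'[of "arcs_ends G" "verts G"] \<open>verts G \<noteq> {}\<close> by blast
    obtain e where e: "e \<in> arcs G" "head G e = z"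
      using in_arc[OF z(1)] by blast
    then have "(tail G e, z) \<in> arcs_ends G"
      by (auto simp: arcs_ends_conv)
    then show False
      using z(2) tail_in_verts[OF e(1)] by blast
  qed
  then obtain u where "u \<rightarrow>\<^sup>+ u"
    by (auto simp: acyclic_def)
  then obtain p where "awalk u p u" "p \<noteq> []"
    unfolding reachable1_awalk by blast
  then show ?thesis
    by (intro closed_w_imp_cycle) (auto simp: closed_w_def)
qed

lemma leader_graph_cycle_in_closed_set:
  fixes L :: "'n::finite \<Rightarrow> 'n set"
  assumes "S \<noteq> {}"
    and leaders_nonempty: "\<And>j. j \<in> S \<Longrightarrow> L j \<noteq> {}"
    and leaders_closed: "\<And>j. j \<in> S \<Longrightarrow> L j \<subseteq> S"
  obtains c where "pre_digraph.cycle (leader_graph L) c" "cycle_users c \<subseteq> S"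
proof -
  \<comment> \<open>Only the heads of arcs are required to lie in \<open>S\<close>; the tails do too
    because \<open>S\<close> is closed under leaders. This makes \<open>H\<close> well-formed and
    later puts \<open>cycle_users c\<close>, which collects tails, inside \<open>S\<close>.\<close>
  define H where "H = \<lparr>verts = S, arcs = {(i, j). j \<in> S \<and> i \<in> L j}, tail = fst, head = snd\<rparr>"
  interpret H: wf_digraph H
    using leaders_closed by unfold_locales (auto simp: H_def subset_iff)
  interpret G: wf_digraph "leader_graph L"
    by unfold_locales (auto simp: leader_graph_def)
  have "\<exists>c. H.cycle c"
    using assms by (intro H.exists_cycle_of_in_arcs) (fastforce simp: H_def)+
  then obtain c where c: "H.cycle c" ..
  have "subgraph H (leader_graph L)"
    using H.wf_digraph_axioms G.wf_digraph_axioms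
    by (auto simp: subgraph_def compatible_def H_def leader_graph_def)
  then have "G.cycle c"
    using c by (rule G.subgraph_cycle)
  moreover have "cycle_users c \<subseteq> S"
  proof -
    have "set c \<subseteq> arcs H"
      using c by (auto simp: H.cycle_def H.awalk_def)
    then show ?thesis
      using leaders_closed by (fastforce simp: H_def cycle_users_def)
  qed
  ultimately show thesis
    by (rule that)
qed

lemma A_mat_mult_component:
  "(A_mat L lam mu *v x) $ j = (\<Sum>k\<in>L j. mu k * x $ k) / (\<Sum>l\<in>L j. lam l + mu l)"
proof -
  have "(A_mat L lam mu *v x) $ j
      = (\<Sum>k\<in>UNIV. of_bool (k \<in> L j) * (mu k * x $ k / (\<Sum>l\<in>L j. lam l + mu l)))"
    unfolding A_mat_def matrix_vector_mult_def by (simp add: mult_ac)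
  also have "\<dots> = (\<Sum>k\<in>L j. mu k * x $ k / (\<Sum>l\<in>L j. lam l + mu l))"
    by (rule sum.mono_neutral_cong_right) auto
  finally show ?thesis
    by (simp add: sum_divide_distrib)
qed

text \<open>Equality must hold in the triangle inequality estimate of row \<open>j\<close>: the
  slack is a sum of nonnegative terms, one per leader, with total at most zero, so each term
  vanishes.\<close>

lemma maximal_component_leaders:
  fixes L :: "'n::finite \<Rightarrow> 'n set" and lam mu :: "'n \<Rightarrow> real"
  assumes "L j \<noteq> {}"
    and lam_nonneg: "\<And>n. lam n \<ge> 0"
    and mu_nonneg: "\<And>n. mu n \<ge> 0"
    and rates_pos: "\<And>n. lam n + mu n > 0"
    and fixed_point: "A_mat L lam mu *v x = x"
    and max: "\<And>k. \<bar>x $ k\<bar> \<le> \<bar>x $ j\<bar>"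
    and "x $ j \<noteq> 0"
    and "k \<in> L j"
  shows "lam k = 0 \<and> \<bar>x $ k\<bar> = \<bar>x $ j\<bar>"
proof -
  define M where "M = \<bar>x $ j\<bar>"
  define s where "s = (\<Sum>l\<in>L j. lam l + mu l)"
  have "M > 0"
    using \<open>x $ j \<noteq> 0\<close> by (simp add: M_def)
  have "s > 0"
    unfolding s_def using assms by (intro sum_pos) auto
  \<comment> \<open>The slack of leader \<open>l\<close>, that is
    \<open>(lam l + mu l) * M - mu l * \<bar>x $ l\<bar>\<close>, split into two nonnegative parts.
    Its sum over \<open>L j\<close> is \<open>M * s\<close> minus the bound on \<open>M * s\<close>
    derived below.\<close>
  define t where "t l = lam l * M + mu l * (M - \<bar>x $ l\<bar>)" for l
  have t_nonneg: "t l \<ge> 0" for l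
    using lam_nonneg mu_nonneg \<open>M > 0\<close> max unfolding t_def M_def by simp
  have "x $ j = (\<Sum>l\<in>L j. mu l * x $ l) / s"
    using A_mat_mult_component[of L lam mu x j] fixed_point by (simp add: s_def)
  then have "M * s = \<bar>\<Sum>l\<in>L j. mu l * x $ l\<bar>"
    using \<open>s > 0\<close> by (simp add: M_def)
  also have "\<dots> \<le> (\<Sum>l\<in>L j. mu l * \<bar>x $ l\<bar>)"
    using sum_abs[of "\<lambda>l. mu l * x $ l" "L j"] mu_nonneg by (simp add: abs_mult)
  finally have "sum t (L j) \<le> 0"
    by (simp add: s_def t_def algebra_simps sum.distrib sum_subtractf sum_distrib_left)
  then have "sum t (L j) = 0"
    using t_nonneg by (simp add: order_antisym sum_nonneg)
  then have "t k = 0"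
    using t_nonneg \<open>k \<in> L j\<close> by (simp add: sum_nonneg_eq_0_iff)
  moreover have "lam k * M \<ge> 0" "mu k * (M - \<bar>x $ k\<bar>) \<ge> 0"
    using lam_nonneg mu_nonneg \<open>M > 0\<close> max unfolding M_def by simp_all
  ultimately have zero: "lam k * M = 0" "mu k * (M - \<bar>x $ k\<bar>) = 0"
    unfolding t_def by linarith+
  then have "lam k = 0"
    using \<open>M > 0\<close> by simp
  \<comment> \<open>With \<open>lam k = 0\<close> the whole rate of \<open>k\<close> is re-posting,
    so the factor \<open>mu k\<close> can be cancelled in \<open>zero\<close>.\<close>
  then have "mu k \<noteq> 0"
    using rates_pos[of k] by simp
  then show ?thesis
    using zero \<open>lam k = 0\<close> by (simp add: M_def)
qed

lemma A_mat_fixed_point_eq_0: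
  fixes L :: "'n::finite \<Rightarrow> 'n set" and lam mu :: "'n \<Rightarrow> real"
  assumes leaders_nonempty: "\<And>n. L n \<noteq> {}"
    and lam_nonneg: "\<And>n. lam n \<ge> 0"
    and mu_nonneg: "\<And>n. mu n \<ge> 0"
    and rates_pos: "\<And>n. lam n + mu n > 0"
    and cs: "cs1 lam \<or> cs2 L lam"
    and fixed_point: "A_mat L lam mu *v x = x"
  shows "x = 0"
proof (rule ccontr)
  assume "x \<noteq> 0"
  define M where "M = Max (range (\<lambda>k. \<bar>x $ k\<bar>))"
  define S where "S = {j. \<bar>x $ j\<bar> = M}"
  have max: "\<bar>x $ k\<bar> \<le> M" for k
    by (simp add: M_def)
  have "M \<in> range (\<lambda>k. \<bar>x $ k\<bar>)"
    unfolding M_def by (intro Max_in) auto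
  then have "S \<noteq> {}"
    by (auto simp: S_def)
  have "M \<noteq> 0"
    using \<open>x \<noteq> 0\<close> max by (fastforce simp: vec_eq_iff)
  have leaders: "lam k = 0 \<and> k \<in> S" if "j \<in> S" "k \<in> L j" for j k
    using maximal_component_leaders[of L j lam mu x k, OF leaders_nonempty lam_nonneg mu_nonneg
        rates_pos fixed_point] max that \<open>M \<noteq> 0\<close>
    by (auto simp: S_def)
  obtain c where c: "pre_digraph.cycle (leader_graph L) c" "cycle_users c \<subseteq> S"
    using leader_graph_cycle_in_closed_set[of S L] \<open>S \<noteq> {}\<close> leaders_nonempty leaders by blast
  \<comment> \<open>Under \<open>cs1\<close>, any user in \<open>S\<close> with any of its leaders
    will do; under \<open>cs2\<close>, the user is found on the cycle \<open>c\<close>.\<close>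
  obtain j k where "j \<in> S" "k \<in> L j" "lam k > 0"
    using cs
  proof
    assume "cs1 lam"
    then show thesis
      using that \<open>S \<noteq> {}\<close> leaders_nonempty unfolding cs1_def by blast
  next
    assume "cs2 L lam"
    then show thesis
      using that c unfolding cs2_def by blast
  qed
  then show False
    using leaders by fastforce
qed

lemma
  assumes "invertible A"
  shows matrix_inv_right_inverse: "A ** matrix_inv A = mat 1"
    and matrix_inv_left_inverse: "matrix_inv A ** A = mat 1"
  using someI_ex[OF assms[unfolded invertible_def]] by (simp_all add: matrix_inv_def)

lemma fixed_point_iff_matrix_inv:
  fixes A :: "real^'n^'n"
  assumes "invertible (mat 1 - A)"
  shows "p = A *v p + b \<longleftrightarrow> p = matrix_inv (mat 1 - A) *v b"
proof -
  let ?B = "mat 1 - A"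
  have "p = A *v p + b \<longleftrightarrow> ?B *v p = b"
    by (auto simp: matrix_vector_mult_diff_rdistrib algebra_simps)
  also have "\<dots> \<longleftrightarrow> p = matrix_inv ?B *v b"
    using matrix_inv_right_inverse[OF assms] matrix_inv_left_inverse[OF assms]
    by (metis matrix_vector_mul_assoc matrix_vector_mul_lid)
  finally show ?thesis .
qed

theorem theorem3:
  fixes L :: "'n::finite \<Rightarrow> 'n set" and lam mu :: "'n \<Rightarrow> real"
  assumes leaders_nonempty: "\<And>n. L n \<noteq> {}"
    and not_own_leader: "\<And>n. n \<notin> L n"
    and lam_nonneg: "\<And>n. lam n \<ge> 0"
    and mu_nonneg: "\<And>n. mu n \<ge> 0"
    and rates_pos: "\<And>n. lam n + mu n > 0"
    and cs: "cs1 lam \<or> cs2 L lam"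
  shows "invertible (mat 1 - A_mat L lam mu) \<and>
    (\<forall>i. (\<exists>!pq. solves_system L lam mu i (fst pq) (snd pq)) \<and>
      solves_system L lam mu i
        (matrix_inv (mat 1 - A_mat L lam mu) *v b_vec L lam mu i)
        ((C_mat lam mu ** matrix_inv (mat 1 - A_mat L lam mu)) *v b_vec L lam mu i
          + d_vec lam mu i))"
proof -
  let ?B = "mat 1 - A_mat L lam mu"
  \<comment> \<open>The kernel of \<open>?B\<close> consists of the fixed points of
    \<open>A_mat L lam mu\<close>; as \<open>?B\<close> is square, a trivial kernel gives
    invertibility.\<close>
  have "x = 0" if "?B *v x = 0" for x
    using that A_mat_fixed_point_eq_0[OF leaders_nonempty lam_nonneg mu_nonneg rates_pos cs]
    by (simp add: matrix_vector_mult_diff_rdistrib)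
  then have inv: "invertible ?B"
    unfolding invertible_left_inverse matrix_left_invertible_ker by blast
  \<comment> \<open>An equivalence with explicit formulas for \<open>p\<close> and \<open>q\<close>
    yields existence, uniqueness and the stated solution at once.\<close>
  have "solves_system L lam mu i p q \<longleftrightarrow>
      p = matrix_inv ?B *v b_vec L lam mu i \<and>
      q = (C_mat lam mu ** matrix_inv ?B) *v b_vec L lam mu i + d_vec lam mu i" for i p q
    unfolding solves_system_def fixed_point_iff_matrix_inv[OF inv]
    by (auto simp: matrix_vector_mul_assoc)
  then show ?thesis
    using inv by (auto simp: prod_eq_iff intro!: ex1I)
qed

end
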